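(* Let $X=(\mathbb{R}^d,\|\cdot\|_X)$ be a real normed linear space with $k(X)\leq 2d-1$ and let $G=(V,E)$ be a graph with at least $d+1$ vertices. Then $$a(G,X)\leq \frac{\gamma(X)}{2d-k(X)}\,a(G).$$
   Context: All graphs are finite and simple. For a graph $G=(V,E)$, $a(G)$ denotes its algebraic connectivity, the second smallest eigenvalue of its Laplacian matrix $L(G)$. For a real symmetric $N\times N$ matrix $A$, $\lambda_1(A)\le\cdots\le\lambda_N(A)$ denote its eigenvalues repeated with multiplicity. Let $X=(\mathbb{R}^d,\|\cdot\|_X)$ be a real normed space, with dual norm $\|\varphi\|_X^*=\sup_{\|x\|_X=1}|\varphi(x)|$ on linear functionals (identified with row vectors in $\mathbb{R}^{1\times d}$). A support functional for a point $x_0$ with $\|x_0\|_X=1$ is a linear functional $\varphi$ with $\varphi(x_0)=1$ and $\|\varphi\|_X^*=1$; the norm is smooth at $x_0$ if $x_0$ has exactly one support functional. A framework in $X$ is a pair $(G,p)$ with $p=(p_v)_{v\in V}\in(\mathbb{R}^d)^V$ such that for every edge $vw$, $p_v\neq p_w$ and the norm is smooth at $(p_v-p_w)/\|p_v-p_w\|_X$; $\mathcal{W}(G,X)$ is the set of such $p$. For an edge $vw$, $\varphi_{v,w}\in\mathbb{R}^{1\times d}$ is the unique support functional of $(p_v-p_w)/\|p_v-p_w\|_X$ (so $\varphi_{w,v}=-\varphi_{v,w}$). The rigidity matrix $R(G,p)$ is the $|E|\times d|V|$ matrix whose row for edge $vw$ has $\varphi_{v,w}$ in the $d$ columns of $v$,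 $\varphi_{w,v}$ in the $d$ columns of $w$ and zeros elsewhere; the framework Laplacian is $L(G,p)=R(G,p)^\top R(G,p)$. A rigid motion of $X$ is a family of continuous paths $\alpha_x:(-1,1)\to\mathbb{R}^d$, $x\in\mathbb{R}^d$, with $\alpha_x(0)=x$, each $\alpha_x$ differentiable at $0$, and $\|\alpha_x(t)-\alpha_y(t)\|_X=\|x-y\|_X$ for all $t,x,y$; the map $\eta(x)=\alpha_x'(0)$ is an infinitesimal rigid motion, the infinitesimal rigid motions form a real vector space $\mathcal{T}(X)$, and $k(X)=\dim\mathcal{T}(X)$. For a graph $G$ with at least $d+1$ vertices, the algebraic connectivity of $G$ in $X$ is $a(G,X)=\sup\{\lambda_{k(X)+1}(L(G,p)):p\in\mathcal{W}(G,X)\}$. Finally $\gamma(X)=\max\{\|f\|_2^2: f\in\mathbb{R}^d,\ \|f\|_X^*=1\}$, where $\|\cdot\|_2$ is the Euclidean norm. *)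

theory Defs
  imports "HOL-Analysis.Analysis" "HOL-Library.Function_Algebras"
begin

text \<open>The vertex set is a finite type; edges are two-element sets of vertices.\<close>

definition simple_graph :: "'v::finite set set \<Rightarrow> bool" where
  "simple_graph E \<longleftrightarrow> (\<forall>e\<in>E. card e = 2)"

definition graph_laplacian :: "'v::finite set set \<Rightarrow> real^'v^'v" where
  "graph_laplacian E = (\<chi> u w. if u = w then real (card {e \<in> E. u \<in> e})
                               else if {u, w} \<in> E then -1 else 0)"

definition eigenspace :: "real^'n^'n \<Rightarrow> real \<Rightarrow> (real^'n) set" where
  "eigenspace A c = {x. A *v x = c *\<^sub>R x}"

text \<open>Eigenvalues in nondecreasing order, each repeated according to the dimension of its
  eigenspace; for symmetric matrices (the only ones used here) this agrees with the
  algebraic multiplicity, so the list has as many entries as the matrix has rows.\<close>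

definition eigenvalue_list :: "real^'n^'n \<Rightarrow> real list" where
  "eigenvalue_list A =
     concat (map (\<lambda>c. replicate (dim (eigenspace A c)) c)
                 (sorted_list_of_set {c. \<exists>x. x \<noteq> 0 \<and> x \<in> eigenspace A c}))"

text \<open>Indexing is from 1: \<open>ordered_eigenvalue 1 A\<close> is the smallest eigenvalue.\<close>

definition ordered_eigenvalue :: "nat \<Rightarrow> real^'n^'n \<Rightarrow> real" where
  "ordered_eigenvalue i A = eigenvalue_list A ! (i - 1)"

definition algebraic_connectivity :: "'v::finite set set \<Rightarrow> real" where
  "algebraic_connectivity E = ordered_eigenvalue 2 (graph_laplacian E)"

definition is_norm :: "(real^'d \<Rightarrow> real) \<Rightarrow> bool" where
  "is_norm N \<longleftrightarrow> (\<forall>x. N x = 0 \<longleftrightarrow> x = 0) \<and>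
                 (\<forall>c x. N (c *\<^sub>R x) = \<bar>c\<bar> * N x) \<and>
                 (\<forall>x y. N (x + y) \<le> N x + N y)"

text \<open>A linear functional is identified with the vector \<open>f\<close> representing it as
  \<open>\<lambda>x. f \<bullet> x\<close>, that is, with its row vector.\<close>

definition dual_norm :: "(real^'d \<Rightarrow> real) \<Rightarrow> real^'d \<Rightarrow> real" where
  "dual_norm N f = (SUP x\<in>{x. N x = 1}. \<bar>f \<bullet> x\<bar>)"

definition support_functional :: "(real^'d \<Rightarrow> real) \<Rightarrow> real^'d \<Rightarrow> real^'d \<Rightarrow> bool" where
  "support_functional N x0 f \<longleftrightarrow> f \<bullet> x0 = 1 \<and> dual_norm N f = 1"

definition smooth_at :: "(real^'d \<Rightarrow> real) \<Rightarrow> real^'d \<Rightarrow> bool" where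
  "smooth_at N x0 \<longleftrightarrow> (\<exists>!f. support_functional N x0 f)"

text \<open>The set is nonempty and compact, so the supremum is a maximum; the norm
  inside is the Euclidean one.\<close>

definition gamma_const :: "(real^'d \<Rightarrow> real) \<Rightarrow> real" where
  "gamma_const N = (SUP f\<in>{f. dual_norm N f = 1}. (norm f)\<^sup>2)"

definition rigid_motion :: "(real^'d \<Rightarrow> real) \<Rightarrow> (real^'d \<Rightarrow> real \<Rightarrow> real^'d) \<Rightarrow> bool" where
  "rigid_motion N \<alpha> \<longleftrightarrow>
     (\<forall>x. continuous_on {-1<..<1} (\<alpha> x) \<and> \<alpha> x 0 = x \<and> \<alpha> x differentiable (at 0)) \<and>
     (\<forall>t\<in>{-1<..<1}. \<forall>x y. N (\<alpha> x t - \<alpha> y t) = N (x - y))"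

definition infinitesimal_rigid_motions :: "(real^'d \<Rightarrow> real) \<Rightarrow> (real^'d \<Rightarrow> real^'d) set" where
  "infinitesimal_rigid_motions N =
     {(\<lambda>x. vector_derivative (\<alpha> x) (at 0)) |\<alpha>. rigid_motion N \<alpha>}"

text \<open>The dimension is taken in the real vector space of all maps with pointwise operations.\<close>

lemma vector_space_fun_scaleR:
  "vector_space (\<lambda>(c::real) (f :: 'a \<Rightarrow> 'b::real_vector) x. c *\<^sub>R f x)"
  by unfold_locales (auto simp: fun_eq_iff algebra_simps)

definition rigid_motion_dim :: "(real^'d \<Rightarrow> real) \<Rightarrow> nat" where
  "rigid_motion_dim N =
     vector_space.dim (\<lambda>(c::real) (f :: real^'d \<Rightarrow> real^'d) x. c *\<^sub>R f x)
       (infinitesimal_rigid_motions N)"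

definition unit_direction ::
    "(real^'d \<Rightarrow> real) \<Rightarrow> ('v \<Rightarrow> real^'d) \<Rightarrow> 'v \<Rightarrow> 'v \<Rightarrow> real^'d" where
  "unit_direction N p v w = (1 / N (p v - p w)) *\<^sub>R (p v - p w)"

definition framework_placements ::
    "(real^'d \<Rightarrow> real) \<Rightarrow> 'v::finite set set \<Rightarrow> ('v \<Rightarrow> real^'d) set" where
  "framework_placements N E =
     {p. \<forall>v w. {v, w} \<in> E \<longrightarrow> p v \<noteq> p w \<and> smooth_at N (unit_direction N p v w)}"

definition edge_functional ::
    "(real^'d \<Rightarrow> real) \<Rightarrow> ('v \<Rightarrow> real^'d) \<Rightarrow> 'v \<Rightarrow> 'v \<Rightarrow> real^'d" where
  "edge_functional N p v w = (THE f. support_functional N (unit_direction N p v w) f)"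

text \<open>Rows are indexed by edges and columns by pairs of a vertex and a coordinate; the
  edge set is not a type, so the matrix is given by its entry function, meant for
  \<open>e \<in> E\<close> only. For \<open>u \<in> e\<close> the vertex \<open>w\<close> with \<open>e = {u, w}\<close> is the other endpoint.\<close>

definition rigidity_matrix ::
    "(real^'d \<Rightarrow> real) \<Rightarrow> ('v \<Rightarrow> real^'d) \<Rightarrow> 'v set \<Rightarrow> 'v \<times> 'd \<Rightarrow> real" where
  "rigidity_matrix N p e = (\<lambda>(u, i).
     if u \<in> e then edge_functional N p u (THE w. e = {u, w}) $ i else 0)"

definition framework_laplacian ::
    "(real^'d \<Rightarrow> real) \<Rightarrow> 'v::finite set set \<Rightarrow> ('v \<Rightarrow> real^'d)
      \<Rightarrow> real^('v \<times> 'd)^('v \<times> 'd)" where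
  "framework_laplacian N E p =
     (\<chi> a b. \<Sum>e\<in>E. rigidity_matrix N p e a * rigidity_matrix N p e b)"

definition algebraic_connectivity_in ::
    "(real^'d \<Rightarrow> real) \<Rightarrow> 'v::finite set set \<Rightarrow> real" where
  "algebraic_connectivity_in N E =
     (SUP p\<in>framework_placements N E.
        ordered_eigenvalue (rigid_motion_dim N + 1) (framework_laplacian N E p))"

end

theory Submission
  imports Defs
begin

text \<open>Let \<open>y\<close> be a unit vector orthogonal to the constants whose Rayleigh quotient for the graph
  Laplacian is at most \<open>a(G)\<close>. On the \<open>2d\<close>-dimensional space \<open>W\<close> of all \<open>y \<otimes> z + 1 \<otimes> c\<close>
  the framework Laplacian has trace \<open>\<Sum>\<^sub>v\<^sub>w (y\<^sub>v - y\<^sub>w)\<^sup>2 |\<phi>\<^sub>v\<^sub>w|\<^sup>2 \<le> \<gamma>(X) a(G)\<close>. The orthogonal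
  complement of the eigenspaces below \<open>\<lambda>\<^sub>k\<^sub>+\<^sub>1\<close> meets \<open>W\<close> in dimension at least \<open>2d - k\<close>, and
  each vector of an orthonormal basis of the intersection contributes at least \<open>\<lambda>\<^sub>k\<^sub>+\<^sub>1\<close> to the
  trace. The supremum defining \<open>a(G,X)\<close> is over a nonempty set: place all vertices on a line
  through a smooth point of the norm.\<close>

section \<open>Eigenvalues of symmetric matrices\<close>

lemma symmetric_matrix_inner:
  fixes A :: "real^'n^'n"
  assumes "transpose A = A"
  shows "(A *v x) \<bullet> y = x \<bullet> (A *v y)"
  by (metis assms dot_lmul_matrix vector_transpose_matrix)

lemma subspace_eigenspace: "subspace (eigenspace A c)"
  by (auto simp: eigenspace_def subspace_def matrix_vector_right_distrib
      matrix_vector_mult_scaleR algebra_simps)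

lemma eigenspace_orthogonal:
  fixes A :: "real^'n^'n"
  assumes "transpose A = A" "x \<in> eigenspace A c" "y \<in> eigenspace A c'" "c \<noteq> c'"
  shows "x \<bullet> y = 0"
proof -
  have "c * (x \<bullet> y) = c' * (x \<bullet> y)"
    using symmetric_matrix_inner[OF assms(1), of x y] assms(2,3) by (simp add: eigenspace_def)
  then show ?thesis using assms(4) by simp
qed

text \<open>Eigenvectors chosen one per eigenvalue are nonzero and pairwise orthogonal, hence
  independent, and a Euclidean space has only finite independent sets. This makes the
  \<open>sorted_list_of_set\<close> in \<open>eigenvalue_list\<close> meaningful.\<close>

lemma finite_eigenvalues:
  fixes A :: "real^'n^'n"
  assumes "transpose A = A"
  shows "finite {c. \<exists>x. x \<noteq> 0 \<and> x \<in> eigenspace A c}" (is "finite ?C")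
proof -
  obtain f where f: "\<And>c. c \<in> ?C \<Longrightarrow> f c \<noteq> 0 \<and> f c \<in> eigenspace A c"
    using bchoice[of ?C "\<lambda>c x. x \<noteq> 0 \<and> x \<in> eigenspace A c"] by auto
  have orth: "f c \<bullet> f c' = 0" if "c \<in> ?C" "c' \<in> ?C" "c \<noteq> c'" for c c'
    using eigenspace_orthogonal[OF assms] f that by blast
  have "inj_on f ?C"
  proof (rule inj_onI, rule ccontr)
    fix c c' assume "c \<in> ?C" "c' \<in> ?C" "f c = f c'" "c \<noteq> c'"
    with orth[of c c'] f[of c] show False by simp
  qed
  moreover have "independent (f ` ?C)"
  proof (rule pairwise_orthogonal_independent)
    show "pairwise orthogonal (f ` ?C)"
      unfolding pairwise_def orthogonal_def using orth by blast
    show "0 \<notin> f ` ?C"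
    proof
      assume "0 \<in> f ` ?C"
      then obtain c where "0 = f c" "c \<in> ?C" by (rule imageE)
      with f[of c] show False by simp
    qed
  qed
  then have "finite (f ` ?C)"
    by (rule independent_imp_finite)
  ultimately show ?thesis
    by (rule finite_imageD[rotated])
qed

text \<open>First-order condition at a minimum without derivatives: at
  \<open>t = - b / (q + 1)\<close> a nonzero linear term would outweigh the quadratic one.\<close>

lemma quadratic_nonneg_imp_linear_coeff_zero:
  fixes b q :: real
  assumes "\<And>t. 0 \<le> 2 * t * b + t\<^sup>2 * q" "0 \<le> q"
  shows "b = 0"
proof (rule ccontr)
  assume "b \<noteq> 0"
  define s where "s = 1 / (q + 1)"
  have s: "0 < s" "s * q \<le> 1"
    using assms(2) by (simp_all add: s_def divide_simps)
  have "2 * (- b * s) * b + (- b * s)\<^sup>2 * q = b\<^sup>2 * s * (s * q - 2)"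
    by (simp add: power2_eq_square algebra_simps)
  also have "\<dots> < 0"
    using s \<open>b \<noteq> 0\<close> by (intro mult_pos_neg) auto
  finally show False using assms(1)[of "- b * s"] by simp
qed

text \<open>The Rayleigh quotient attains its minimum on the compact unit sphere of
  \<open>S\<close>. Invariance keeps the residual of the minimiser inside \<open>S\<close>, so that
  it is an admissible direction of variation.\<close>

lemma invariant_subspace_min_eigenvector:
  fixes A :: "real^'n^'n"
  assumes sym: "transpose A = A" and S: "subspace S" "S \<noteq> {0}"
    and inv: "\<And>x. x \<in> S \<Longrightarrow> A *v x \<in> S"
  obtains c x where "x \<in> S" "norm x = 1" "A *v x = c *\<^sub>R x"
    "\<And>z. z \<in> S \<Longrightarrow> c * (norm z)\<^sup>2 \<le> z \<bullet> (A *v z)"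
proof -
  obtain s where s: "s \<in> S" "s \<noteq> 0"
    using S subspace_0 by blast
  have "compact (S \<inter> sphere 0 1)"
    by (intro closed_Int_compact closed_subspace S compact_sphere)
  moreover have "(1 / norm s) *\<^sub>R s \<in> S \<inter> sphere 0 1"
    using s S by (auto intro: subspace_scale)
  then have "S \<inter> sphere 0 1 \<noteq> {}" by blast
  moreover have "continuous_on (S \<inter> sphere 0 1) (\<lambda>x. x \<bullet> (A *v x))"
    by (intro continuous_intros matrix_vector_mult_linear_continuous_on)
  ultimately have "\<exists>x\<in>S \<inter> sphere 0 1. \<forall>y\<in>S \<inter> sphere 0 1. x \<bullet> (A *v x) \<le> y \<bullet> (A *v y)"
    by (rule continuous_attains_inf)
  then obtain x where x: "x \<in> S" "norm x = 1"
    and min: "\<And>y. y \<in> S \<Longrightarrow> norm y = 1 \<Longrightarrow> x \<bullet> (A *v x) \<le> y \<bullet> (A *v y)"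
    by auto
  define c where "c = x \<bullet> (A *v x)"
  have lower: "c * (norm z)\<^sup>2 \<le> z \<bullet> (A *v z)" if "z \<in> S" for z
  proof (cases "z = 0")
    case False
    have "c \<le> ((1 / norm z) *\<^sub>R z) \<bullet> (A *v ((1 / norm z) *\<^sub>R z))"
      unfolding c_def using False that S by (intro min) (auto intro: subspace_scale)
    also have "\<dots> = (z \<bullet> (A *v z)) / (norm z)\<^sup>2"
      by (simp add: matrix_vector_mult_scaleR power2_eq_square)
    finally show ?thesis
      using False by (simp add: field_simps)
  qed simp
  \<comment> \<open>Up to the factor 2, the first variation of the quadratic form minus
    \<open>c\<close> times the squared norm at \<open>x\<close> in direction \<open>h\<close> is
    \<open>h \<bullet> h\<close>; minimality forces it to vanish.\<close>
  define h where "h = A *v x - c *\<^sub>R x"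
  have hS: "h \<in> S"
    unfolding h_def by (intro subspace_diff subspace_scale inv S x)
  have xAh: "x \<bullet> (A *v h) = (A *v x) \<bullet> h"
    using symmetric_matrix_inner[OF sym] by simp
  have "h \<bullet> h = 0"
  proof (rule quadratic_nonneg_imp_linear_coeff_zero)
    show "0 \<le> h \<bullet> (A *v h) - c * (norm h)\<^sup>2"
      using lower[OF hS] by simp
    fix t :: real
    have "x + t *\<^sub>R h \<in> S"
      by (intro subspace_add subspace_scale S x hS)
    then have "0 \<le> (x + t *\<^sub>R h) \<bullet> (A *v (x + t *\<^sub>R h)) - c * (norm (x + t *\<^sub>R h))\<^sup>2"
      using lower by fastforce
    also have "(x + t *\<^sub>R h) \<bullet> (A *v (x + t *\<^sub>R h)) =
        c + 2 * t * ((A *v x) \<bullet> h) + t\<^sup>2 * (h \<bullet> (A *v h))"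
      using xAh by (simp add: matrix_vector_right_distrib matrix_vector_mult_scaleR inner_add_left
          inner_add_right c_def inner_commute power2_eq_square algebra_simps)
    also have "(norm (x + t *\<^sub>R h))\<^sup>2 = 1 + 2 * t * (x \<bullet> h) + t\<^sup>2 * (norm h)\<^sup>2"
      using x(2) unfolding norm_eq_1 power2_norm_eq_inner
      by (simp add: inner_add_left inner_add_right inner_commute power2_eq_square algebra_simps)
    finally show "0 \<le> 2 * t * (h \<bullet> h) + t\<^sup>2 * (h \<bullet> (A *v h) - c * (norm h)\<^sup>2)"
      by (simp add: h_def inner_diff_left inner_diff_right inner_commute algebra_simps)
  qed
  then have "A *v x = c *\<^sub>R x" by (simp add: h_def)
  with x lower show thesis using that by blast
qed

lemma dim_UN_le:
  fixes f :: "'i \<Rightarrow> 'a::euclidean_space set"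
  assumes "finite T"
  shows "dim (\<Union>i\<in>T. f i) \<le> (\<Sum>i\<in>T. dim (f i))"
proof -
  have "\<exists>B. finite B \<and> f i \<subseteq> span B \<and> card B = dim (f i)" for i
    by (metis basis_exists independent_imp_finite)
  then obtain B where B: "\<And>i. finite (B i)" "\<And>i. f i \<subseteq> span (B i)" "\<And>i. card (B i) = dim (f i)"
    by metis
  have "(\<Union>i\<in>T. f i) \<subseteq> span (\<Union>i\<in>T. B i)"
    using B(2) span_mono[of "B _" "\<Union>i\<in>T. B i"] by fastforce
  then have "dim (\<Union>i\<in>T. f i) \<le> card (\<Union>i\<in>T. B i)"
    using assms B(1) by (intro dim_le_card) auto
  also have "\<dots> \<le> (\<Sum>i\<in>T. card (B i))"
    using assms by (rule card_UN_le)
  finally show ?thesis using B(3) by simp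
qed

text \<open>Symmetry makes \<open>V\<close> invariant, so the Rayleigh minimiser on \<open>V\<close>
  is an eigenvector. Its eigenvalue is outside \<open>T\<close>, since otherwise the vector would be
  orthogonal to itself.\<close>

lemma eigenspaces_orthogonal_complement:
  fixes A :: "real^'n^'n" and T :: "real set"
  assumes sym: "transpose A = A"
  defines "V \<equiv> {y. \<forall>x\<in>span (\<Union>c\<in>T. eigenspace A c). orthogonal x y}"
  assumes "V \<noteq> {0}"
  obtains c x where "x \<noteq> 0" "x \<in> eigenspace A c" "c \<notin> T"
    "\<And>z. z \<in> V \<Longrightarrow> c * (norm z)\<^sup>2 \<le> z \<bullet> (A *v z)"
proof -
  have V: "V = {y. \<forall>c\<in>T. \<forall>x\<in>eigenspace A c. x \<bullet> y = 0}"
  proof -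
    have "y \<in> V" if "\<forall>c\<in>T. \<forall>x\<in>eigenspace A c. x \<bullet> y = 0" for y
    proof -
      have "orthogonal y x" if "x \<in> span (\<Union>c\<in>T. eigenspace A c)" for x
        using that \<open>\<forall>c\<in>T. \<forall>x\<in>eigenspace A c. x \<bullet> y = 0\<close>
        by (intro orthogonal_to_span[OF that]) (auto simp: orthogonal_def inner_commute)
      then show ?thesis
        by (simp add: V_def orthogonal_commute)
    qed
    moreover have "x \<bullet> y = 0" if "y \<in> V" "c \<in> T" "x \<in> eigenspace A c" for x y c
      using that unfolding V_def orthogonal_def by (blast intro: span_base)
    ultimately show ?thesis by blast
  qed
  have sub: "subspace V"
    by (auto simp: V subspace_def inner_add_right)
  have inv: "A *v y \<in> V" if "y \<in> V" for y
  proof -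
    have "x \<bullet> (A *v y) = c * (x \<bullet> y)" if "x \<in> eigenspace A c" for x c
      using symmetric_matrix_inner[OF sym, of x y] that by (simp add: eigenspace_def)
    then show ?thesis
      using that by (auto simp: V)
  qed
  obtain c x where x: "x \<in> V" "norm x = 1" "A *v x = c *\<^sub>R x"
    and lower: "\<And>z. z \<in> V \<Longrightarrow> c * (norm z)\<^sup>2 \<le> z \<bullet> (A *v z)"
    using invariant_subspace_min_eigenvector[OF sym sub assms(3) inv] by blast
  have "c \<notin> T"
    using x by (auto simp: V eigenspace_def norm_eq_1)
  then show thesis
    using that[of x c, OF _ _ _ lower] x by (force simp: eigenspace_def)
qed

lemma orthogonal_complement_dim:
  fixes S :: "(real^'n) set"
  shows "dim {y. \<forall>x\<in>span S. orthogonal x y} + dim S = CARD('n)"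
  using dim_subspace_orthogonal_to_vectors[of "span S" UNIV] by simp

section \<open>Counting in the eigenvalue list\<close>

lemma length_filter_eigenvalue_list:
  fixes A :: "real^'n^'n"
  assumes "transpose A = A"
  shows "length (filter P (eigenvalue_list A)) =
    (\<Sum>c | (\<exists>x. x \<noteq> 0 \<and> x \<in> eigenspace A c) \<and> P c. dim (eigenspace A c))"
proof -
  let ?C = "{c. \<exists>x. x \<noteq> 0 \<and> x \<in> eigenspace A c}"
  have fin: "finite ?C" by (rule finite_eigenvalues[OF assms])
  have "length (filter P (eigenvalue_list A)) =
      (\<Sum>c\<leftarrow>sorted_list_of_set ?C. if P c then dim (eigenspace A c) else 0)"
    unfolding eigenvalue_list_def filter_concat length_concat map_map comp_def
    by (intro arg_cong[where f = sum_list] map_cong) auto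
  also have "\<dots> = (\<Sum>c\<in>?C. if P c then dim (eigenspace A c) else 0)"
    using fin by (subst sum_list_distinct_conv_sum_set) auto
  also have "\<dots> = (\<Sum>c\<in>{c \<in> ?C. P c}. dim (eigenspace A c))"
    using fin by (rule sum.inter_filter[symmetric])
  finally show ?thesis by simp
qed

text \<open>With \<open>T\<close> the set of all eigenvalues, a nonzero complement would produce a
  further one; so the eigenspaces span the space. The bound keeps the later list lookups in
  range.\<close>

lemma length_eigenvalue_list_ge:
  fixes A :: "real^'n^'n"
  assumes "transpose A = A"
  shows "CARD('n) \<le> length (eigenvalue_list A)"
proof -
  let ?C = "{c. \<exists>x. x \<noteq> 0 \<and> x \<in> eigenspace A c}"
  have "{y. \<forall>x\<in>span (\<Union>c\<in>?C. eigenspace A c). orthogonal x y} = {0}"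
    using eigenspaces_orthogonal_complement[OF assms, of ?C] by blast
  then have "CARD('n) = dim (\<Union>c\<in>?C. eigenspace A c)"
    using orthogonal_complement_dim[of "\<Union>c\<in>?C. eigenspace A c"] by simp
  also have "\<dots> \<le> (\<Sum>c\<in>?C. dim (eigenspace A c))"
    by (rule dim_UN_le[OF finite_eigenvalues[OF assms]])
  also have "\<dots> = length (eigenvalue_list A)"
    using length_filter_eigenvalue_list[OF assms, of "\<lambda>_. True"] by simp
  finally show ?thesis .
qed

lemma sorted_concat_replicate:
  "sorted xs \<Longrightarrow> sorted (concat (map (\<lambda>c. replicate (m c) c) xs))"
  by (induction xs) (auto simp: sorted_append sorted_replicate)

lemma sorted_eigenvalue_list: "sorted (eigenvalue_list A)"
  unfolding eigenvalue_list_def by (intro sorted_concat_replicate sorted_sorted_list_of_set)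

lemma sorted_length_filter_less_nth:
  assumes "sorted xs" "i < length xs"
  shows "length (filter (\<lambda>x. x < xs ! i) xs) \<le> i"
proof -
  have "{j. j < length xs \<and> xs ! j < xs ! i} \<subseteq> {..<i}"
    using assms by (metis (mono_tags, lifting) lessThan_iff linorder_not_less mem_Collect_eq
        sorted_nth_mono subsetI)
  then show ?thesis
    unfolding length_filter_conv_card using card_mono[OF finite_lessThan] by fastforce
qed

lemma sorted_length_filter_le_nth:
  assumes "sorted xs" "i < length xs"
  shows "Suc i \<le> length (filter (\<lambda>x. x \<le> xs ! i) xs)"
proof -
  have "{..i} \<subseteq> {j. j < length xs \<and> xs ! j \<le> xs ! i}"
    using assms by (auto intro: sorted_nth_mono)
  then have "card {..i} \<le> card {j. j < length xs \<and> xs ! j \<le> xs ! i}"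
    by (intro card_mono) auto
  then show ?thesis
    by (simp add: length_filter_conv_card)
qed

text \<open>One half of the Courant-Fischer principle: remove the eigenspaces below the eigenvalue
  in question. Their total dimension is at most \<open>i\<close>, and every eigenvalue left is large
  enough.\<close>

lemma ordered_eigenvalue_lower_bound_subspace:
  fixes A :: "real^'n^'n"
  assumes sym: "transpose A = A" and i: "i < CARD('n)"
  obtains V where "subspace V" "CARD('n) \<le> dim V + i"
    "\<And>z. z \<in> V \<Longrightarrow> ordered_eigenvalue (i + 1) A * (norm z)\<^sup>2 \<le> z \<bullet> (A *v z)"
proof -
  define l where "l = ordered_eigenvalue (i + 1) A"
  \<comment> \<open>The inequality is strict so that a repeated eigenvalue \<open>l\<close> is not
    removed; only then are at most \<open>i\<close> dimensions lost.\<close>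
  define T where "T = {c. (\<exists>x. x \<noteq> 0 \<and> x \<in> eigenspace A c) \<and> c < l}"
  define V where "V = {y. \<forall>x\<in>span (\<Union>c\<in>T. eigenspace A c). orthogonal x y}"
  have len: "i < length (eigenvalue_list A)"
    using i length_eigenvalue_list_ge[OF sym] by simp
  have l: "l = eigenvalue_list A ! i"
    by (simp add: l_def ordered_eigenvalue_def)
  have "finite T"
    unfolding T_def by (rule finite_subset[OF _ finite_eigenvalues[OF sym]]) auto
  then have "dim (\<Union>c\<in>T. eigenspace A c) \<le> (\<Sum>c\<in>T. dim (eigenspace A c))"
    by (rule dim_UN_le)
  also have "\<dots> = length (filter (\<lambda>c. c < l) (eigenvalue_list A))"
    unfolding T_def by (simp add: length_filter_eigenvalue_list[OF sym])
  also have "\<dots> \<le> i"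
    unfolding l by (rule sorted_length_filter_less_nth[OF sorted_eigenvalue_list len])
  finally have "CARD('n) \<le> dim V + i"
    using orthogonal_complement_dim[of "\<Union>c\<in>T. eigenspace A c"] by (simp add: V_def)
  moreover have "l * (norm z)\<^sup>2 \<le> z \<bullet> (A *v z)" if z: "z \<in> V" for z
  proof (cases "V = {0}")
    case False
    obtain c x where c: "x \<noteq> 0" "x \<in> eigenspace A c" "c \<notin> T"
      and "\<And>z. z \<in> V \<Longrightarrow> c * (norm z)\<^sup>2 \<le> z \<bullet> (A *v z)"
      by (rule eigenspaces_orthogonal_complement[OF sym False[unfolded V_def], folded V_def]) blast
    then have "c * (norm z)\<^sup>2 \<le> z \<bullet> (A *v z)" using z by blast
    moreover from c have "l \<le> c" by (auto simp: T_def)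
    then have "l * (norm z)\<^sup>2 \<le> c * (norm z)\<^sup>2"
      by (rule mult_right_mono) simp
    ultimately show ?thesis by simp
  qed (use z in simp)
  moreover have "subspace V"
    by (auto simp: V_def subspace_def orthogonal_def inner_add_right)
  ultimately show thesis by (intro that[of V, folded l_def])
qed

text \<open>The vector \<open>y\<close> minimises the Rayleigh quotient on the complement of
  \<open>u\<close>, with minimum \<open>c\<close>. If \<open>c\<close> exceeded the second list
  entry \<open>m\<close>, the only eigenvectors with eigenvalue at most \<open>m\<close> would be
  multiples of \<open>u\<close>, leaving at most one list entry up to \<open>m\<close> instead of
  two.\<close>

lemma second_eigenvalue_test_vector:
  fixes A :: "real^'n^'n"
  assumes sym: "transpose A = A" and card: "2 \<le> CARD('n)"
    and u: "u \<noteq> 0" "u \<in> eigenspace A a"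
  obtains y where "norm y = 1" "y \<bullet> u = 0" "y \<bullet> (A *v y) \<le> ordered_eigenvalue 2 A"
proof -
  define S where "S = {x. u \<bullet> x = 0}"
  define m where "m = eigenvalue_list A ! 1"
  have S: "subspace S"
    by (auto simp: S_def subspace_def inner_add_right)
  have "{y. \<forall>x\<in>span {u}. orthogonal x y} = S"
    by (auto simp: S_def orthogonal_def span_singleton)
  then have "dim S + dim {u} = CARD('n)"
    using orthogonal_complement_dim[of "{u}"] by simp
  moreover have "dim {u} \<le> 1" using dim_le_card'[of "{u}"] by simp
  ultimately have S0: "S \<noteq> {0}" using card by auto
  have inv: "A *v x \<in> S" if "x \<in> S" for x
    using that symmetric_matrix_inner[OF sym, of u x] u(2) by (simp add: S_def eigenspace_def)
  obtain c y where y: "y \<in> S" "norm y = 1" "A *v y = c *\<^sub>R y"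
    and lower: "\<And>z. z \<in> S \<Longrightarrow> c * (norm z)\<^sup>2 \<le> z \<bullet> (A *v z)"
    using invariant_subspace_min_eigenvector[OF sym S S0 inv] by blast
  have "c \<le> m"
  proof (rule ccontr)
    assume "\<not> c \<le> m"
    \<comment> \<open>On \<open>S\<close> the Rayleigh quotient is at least \<open>c\<close>, and
      \<open>c > m \<ge> b\<close>.\<close>
    have zero: "x = 0" if "x \<in> eigenspace A b" "x \<in> S" "b \<le> m" for x b
    proof (rule ccontr)
      assume "x \<noteq> 0"
      have "c * (norm x)\<^sup>2 \<le> b * (norm x)\<^sup>2"
        using lower[OF that(2)] that(1) by (simp add: eigenspace_def power2_norm_eq_inner)
      with \<open>x \<noteq> 0\<close> \<open>\<not> c \<le> m\<close> that(3) show False by simp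
    qed
    have only_a: "b = a" if "x \<noteq> 0" "x \<in> eigenspace A b" "b \<le> m" for x b
      using zero[OF that(2) _ that(3)] that(1) eigenspace_orthogonal[OF sym u(2) that(2)]
      by (auto simp: S_def)
    have one: "dim (eigenspace A a) \<le> 1" if "a \<le> m"
    proof -
      have "eigenspace A a \<subseteq> span {u}"
      proof
        fix x assume x: "x \<in> eigenspace A a"
        \<comment> \<open>Subtracting the projection onto \<open>u\<close> stays in the eigenspace
          and lands in \<open>S\<close>, where \<open>zero\<close> applies.\<close>
        let ?z = "x - ((u \<bullet> x) / (u \<bullet> u)) *\<^sub>R u"
        have "?z \<in> eigenspace A a"
          by (intro subspace_diff subspace_scale subspace_eigenspace x u)
        moreover have "?z \<in> S"
          using u(1) by (simp add: S_def inner_diff_right)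
        ultimately have "?z = 0" using zero that by blast
        then have "x = ((u \<bullet> x) / (u \<bullet> u)) *\<^sub>R u" by simp
        then show "x \<in> span {u}" by (metis span_base span_scale singletonI)
      qed
      then show ?thesis using dim_le_card[of _ "{u}"] by simp
    qed
    \<comment> \<open>List positions start at 0, so \<open>m\<close> sits at position 1 and is
      preceded by an entry no larger.\<close>
    have "2 \<le> length (filter (\<lambda>x. x \<le> m) (eigenvalue_list A))"
      using sorted_length_filter_le_nth[OF sorted_eigenvalue_list[of A], of 1]
        length_eigenvalue_list_ge[OF sym] card by (simp add: m_def)
    also have "\<dots> = (\<Sum>b | (\<exists>x. x \<noteq> 0 \<and> x \<in> eigenspace A b) \<and> b \<le> m. dim (eigenspace A b))"
      by (rule length_filter_eigenvalue_list[OF sym])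
    also have "\<dots> \<le> (\<Sum>b | b = a \<and> b \<le> m. dim (eigenspace A b))"
      by (rule sum_mono2) (use only_a in auto)
    also have "\<dots> \<le> 1"
      using one by (cases "a \<le> m") (simp_all add: conj_commute cong: conj_cong)
    finally show False by simp
  qed
  then show thesis
    using that[of y] y by (simp add: S_def m_def ordered_eigenvalue_def inner_commute norm_eq_1)
qed

section \<open>Gram matrices\<close>

text \<open>This is the product of the transpose of \<open>R\<close> with \<open>R\<close>, where
  \<open>R\<close> has rows \<open>r e\<close>. Both Laplacians are brought to this form, with the
  edge set as row index.\<close>

definition gram_matrix :: "'e set \<Rightarrow> ('e \<Rightarrow> real^'n) \<Rightarrow> real^'n^'n" where
  "gram_matrix E r = (\<chi> a b. \<Sum>e\<in>E. r e $ a * r e $ b)"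

lemma transpose_gram_matrix: "transpose (gram_matrix E r) = gram_matrix E r"
  by (simp add: gram_matrix_def transpose_def mult.commute)

lemma gram_matrix_mult_vec: "gram_matrix E r *v x = (\<Sum>e\<in>E. (r e \<bullet> x) *\<^sub>R r e)"
proof -
  have "(gram_matrix E r *v x) $ a = (\<Sum>e\<in>E. (r e \<bullet> x) *\<^sub>R r e) $ a" for a
  proof -
    have "(gram_matrix E r *v x) $ a = (\<Sum>i\<in>UNIV. \<Sum>e\<in>E. r e $ a * r e $ i * x $ i)"
      by (simp add: gram_matrix_def matrix_vector_mult_def sum_distrib_right)
    also have "\<dots> = (\<Sum>e\<in>E. \<Sum>i\<in>UNIV. r e $ a * r e $ i * x $ i)"
      by (rule sum.swap)
    also have "\<dots> = (\<Sum>e\<in>E. (r e \<bullet> x) *\<^sub>R r e) $ a"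
      by (simp add: inner_vec_def sum_distrib_left mult_ac)
    finally show ?thesis .
  qed
  then show ?thesis by (simp add: vec_eq_iff)
qed

lemma gram_matrix_quadratic_form: "x \<bullet> (gram_matrix E r *v x) = (\<Sum>e\<in>E. (r e \<bullet> x)\<^sup>2)"
  by (simp add: gram_matrix_mult_vec inner_sum_right power2_eq_square inner_commute)

lemma Bessel_inequality:
  fixes B :: "'a::real_inner set"
  assumes "finite B" "pairwise orthogonal B" "\<And>b. b \<in> B \<Longrightarrow> norm b = 1"
  shows "(\<Sum>b\<in>B. (z \<bullet> b)\<^sup>2) \<le> (norm z)\<^sup>2"
proof -
  define q where "q = (\<Sum>b\<in>B. (z \<bullet> b) *\<^sub>R b)"
  have qb: "q \<bullet> b = z \<bullet> b" if "b \<in> B" for b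
  proof -
    have "q \<bullet> b = (\<Sum>b'\<in>B. if b' = b then z \<bullet> b else 0)"
      unfolding q_def inner_sum_left
      using assms that by (intro sum.cong) (auto simp: pairwise_def orthogonal_def norm_eq_1)
    then show ?thesis using assms(1) that by simp
  qed
  have "q \<bullet> q = (\<Sum>b\<in>B. (z \<bullet> b) * (q \<bullet> b))"
    by (subst (2) q_def) (simp add: inner_sum_right)
  also have "\<dots> = (\<Sum>b\<in>B. (z \<bullet> b)\<^sup>2)"
    by (intro sum.cong) (auto simp: qb power2_eq_square)
  finally have qq: "q \<bullet> q = (\<Sum>b\<in>B. (z \<bullet> b)\<^sup>2)" .
  have "z \<bullet> q = (\<Sum>b\<in>B. (z \<bullet> b)\<^sup>2)"
    by (simp add: q_def inner_sum_right power2_eq_square)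
  moreover have "0 \<le> (z - q) \<bullet> (z - q)" by simp
  ultimately show ?thesis
    using qq by (simp add: inner_diff_left inner_diff_right inner_commute power2_norm_eq_inner)
qed

text \<open>The vectors \<open>z e\<close> replace the orthogonal projections of the \<open>r e\<close> to \<open>W\<close>, so the
  right-hand side bounds the trace of the compression of the Gram matrix to \<open>W\<close>.\<close>

lemma ordered_eigenvalue_gram_matrix_le:
  fixes r z :: "'e \<Rightarrow> real^'n"
  assumes W: "subspace W" and k: "k < dim W"
    and rz: "\<And>e x. e \<in> E \<Longrightarrow> x \<in> W \<Longrightarrow> r e \<bullet> x = z e \<bullet> x"
  shows "real (dim W - k) * ordered_eigenvalue (k + 1) (gram_matrix E r)
    \<le> (\<Sum>e\<in>E. (norm (z e))\<^sup>2)"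
proof -
  let ?l = "ordered_eigenvalue (k + 1) (gram_matrix E r)"
  have "dim W \<le> CARD('n)" using dim_subset_UNIV[of W] by simp
  then have "k < CARD('n)" using k by simp
  then obtain V where V: "subspace V" "CARD('n) \<le> dim V + k"
    and lower: "\<And>x. x \<in> V \<Longrightarrow> ?l * (norm x)\<^sup>2 \<le> x \<bullet> (gram_matrix E r *v x)"
    using ordered_eigenvalue_lower_bound_subspace[OF transpose_gram_matrix] by blast
  \<comment> \<open>The sum of \<open>W\<close> and \<open>V\<close> fits into the whole space, and
    \<open>V\<close> has codimension at most \<open>k\<close>; hence the intersection has dimension
    at least \<open>dim W - k\<close>.\<close>
  have "dim {x + y |x y. x \<in> W \<and> y \<in> V} + dim (W \<inter> V) = dim W + dim V"
    by (rule dim_sums_Int[OF W V(1)])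
  moreover have "dim {x + y |x y. x \<in> W \<and> y \<in> V} \<le> CARD('n)"
    using dim_subset_UNIV[of "{x + y |x y. x \<in> W \<and> y \<in> V}"] by simp
  ultimately have dimWV: "dim W - k \<le> dim (W \<inter> V)" using V(2) by simp
  obtain B where B: "B \<subseteq> W \<inter> V" "pairwise orthogonal B" "\<And>b. b \<in> B \<Longrightarrow> norm b = 1"
    "card B = dim (W \<inter> V)"
    using orthonormal_basis_subspace[OF subspace_inter[OF W V(1)]] by metis
  \<comment> \<open>Exactly \<open>dim W - k\<close> basis vectors are kept, so the factor on the
    left appears without knowing the sign of \<open>?l\<close>.\<close>
  obtain B' where B': "B' \<subseteq> B" "card B' = dim W - k" "finite B'"
    using dimWV B(4) obtain_subset_with_card_n by metis
  have "real (dim W - k) * ?l = (\<Sum>b\<in>B'. ?l)"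
    using B'(2) by simp
  also have "\<dots> \<le> (\<Sum>b\<in>B'. \<Sum>e\<in>E. (z e \<bullet> b)\<^sup>2)"
  proof (rule sum_mono)
    fix b assume b: "b \<in> B'"
    then have bB: "b \<in> W" "b \<in> V" "norm b = 1" using B B' by auto
    then have "?l \<le> (\<Sum>e\<in>E. (r e \<bullet> b)\<^sup>2)"
      using lower[of b] by (simp add: gram_matrix_quadratic_form)
    also have "\<dots> = (\<Sum>e\<in>E. (z e \<bullet> b)\<^sup>2)"
      using rz bB by (intro sum.cong) auto
    finally show "?l \<le> (\<Sum>e\<in>E. (z e \<bullet> b)\<^sup>2)" .
  qed
  also have "\<dots> = (\<Sum>e\<in>E. \<Sum>b\<in>B'. (z e \<bullet> b)\<^sup>2)"
    by (rule sum.swap)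
  also have "\<dots> \<le> (\<Sum>e\<in>E. (norm (z e))\<^sup>2)"
    using B B' by (intro sum_mono Bessel_inequality) (auto intro: pairwise_subset)
  finally show ?thesis .
qed

section \<open>Norms and support functionals\<close>

lemma is_norm_zero: "is_norm N \<Longrightarrow> N 0 = 0"
  and is_norm_scaleR: "is_norm N \<Longrightarrow> N (c *\<^sub>R x) = \<bar>c\<bar> * N x"
  and is_norm_triangle: "is_norm N \<Longrightarrow> N (x + y) \<le> N x + N y"
  and is_norm_eq_zero: "is_norm N \<Longrightarrow> N x = 0 \<longleftrightarrow> x = 0"
  by (simp_all add: is_norm_def)

lemma is_norm_minus: "is_norm N \<Longrightarrow> N (- x) = N x"
  using is_norm_scaleR[of N "-1" x] by simp

lemma is_norm_nonneg: "is_norm N \<Longrightarrow> 0 \<le> N x"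
  using is_norm_triangle[of N x "- x"] by (simp add: is_norm_minus is_norm_zero)

lemma is_norm_pos: "is_norm N \<Longrightarrow> x \<noteq> 0 \<Longrightarrow> 0 < N x"
  using is_norm_nonneg[of N x] is_norm_eq_zero[of N x] by simp

lemma is_norm_sum: "is_norm N \<Longrightarrow> N (sum f A) \<le> (\<Sum>a\<in>A. N (f a))"
proof (induction A rule: infinite_finite_induct)
  case (insert a A)
  then show ?case using is_norm_triangle[of N "f a" "sum f A"] by simp
qed (simp_all add: is_norm_zero)

text \<open>Expanding in the standard basis bounds \<open>N\<close> by a multiple of the Euclidean
  norm; the triangle inequality then makes \<open>N\<close> Lipschitz.\<close>

lemma is_norm_continuous_on:
  assumes N: "is_norm N"
  shows "continuous_on S N"
proof -
  define C where "C = (\<Sum>b\<in>Basis. N b)"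
  have bound: "N x \<le> C * norm x" for x
  proof -
    have "N x = N (\<Sum>b\<in>Basis. (x \<bullet> b) *\<^sub>R b)" by (simp add: euclidean_representation)
    also have "\<dots> \<le> (\<Sum>b\<in>Basis. N ((x \<bullet> b) *\<^sub>R b))" by (rule is_norm_sum[OF N])
    also have "\<dots> \<le> (\<Sum>b\<in>Basis. norm x * N b)"
      unfolding is_norm_scaleR[OF N]
      by (intro sum_mono mult_right_mono Basis_le_norm is_norm_nonneg[OF N])
    finally show ?thesis by (simp add: C_def sum_distrib_left mult.commute)
  qed
  have "N x - N y \<le> C * norm (x - y)" for x y
    using is_norm_triangle[OF N, of "x - y" y] bound[of "x - y"] by simp
  then have "\<bar>N x - N y\<bar> \<le> C * norm (x - y)" for x y
    by (smt (verit) norm_minus_commute)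
  moreover have "0 \<le> C" unfolding C_def by (intro sum_nonneg is_norm_nonneg[OF N])
  ultimately have "C-lipschitz_on S N"
    by (auto simp: lipschitz_on_def dist_norm)
  then show ?thesis by (rule lipschitz_on_continuous_on)
qed

text \<open>Compactness of the Euclidean sphere. The maximiser itself is kept because the smooth
  point in \<open>smooth_at_exists\<close> is built from it.\<close>

lemma is_norm_upper_bound_attained:
  fixes N :: "real^'d \<Rightarrow> real"
  assumes N: "is_norm N"
  obtains x where "norm x = 1" "\<And>y. N y \<le> N x * norm y"
proof -
  have "sphere (0::real^'d) 1 \<noteq> {}" by simp
  then have "\<exists>x\<in>sphere 0 1. \<forall>y\<in>sphere 0 1. N y \<le> N x"
    by (intro continuous_attains_sup compact_sphere is_norm_continuous_on N)
  then obtain x where x: "norm x = 1" "\<And>y. norm y = 1 \<Longrightarrow> N y \<le> N x" by auto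
  have "N y \<le> N x * norm y" for y
  proof (cases "y = 0")
    case False
    then show ?thesis
      using x(2)[of "(1 / norm y) *\<^sub>R y"] by (simp add: is_norm_scaleR[OF N] field_simps)
  qed (simp add: is_norm_zero[OF N])
  with x(1) that show thesis by blast
qed

lemma is_norm_lower_bound:
  fixes N :: "real^'d \<Rightarrow> real"
  assumes N: "is_norm N"
  obtains m where "0 < m" "\<And>y. m * norm y \<le> N y"
proof -
  have "sphere (0::real^'d) 1 \<noteq> {}" by simp
  then have "\<exists>x\<in>sphere 0 1. \<forall>y\<in>sphere 0 1. N x \<le> N y"
    by (intro continuous_attains_inf compact_sphere is_norm_continuous_on N)
  then obtain x where x: "norm x = 1" "\<And>y. norm y = 1 \<Longrightarrow> N x \<le> N y" by auto
  have "N x * norm y \<le> N y" for y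
  proof (cases "y = 0")
    case False
    then show ?thesis
      using x(2)[of "(1 / norm y) *\<^sub>R y"] by (simp add: is_norm_scaleR[OF N] field_simps)
  qed (simp add: is_norm_zero[OF N])
  moreover have "0 < N x" using x(1) by (intro is_norm_pos[OF N]) auto
  ultimately show thesis using that by blast
qed

text \<open>The supremum in \<open>dual_norm\<close> bounds its members only once the set is known
  to be bounded above; the lower bound \<open>m\<close> on \<open>N\<close> against the Euclidean
  norm gives this.\<close>

lemma dual_norm_inner_le:
  assumes N: "is_norm N"
  shows "\<bar>f \<bullet> x\<bar> \<le> dual_norm N f * N x"
proof (cases "x = 0")
  case False
  obtain m where m: "0 < m" "\<And>y. m * norm y \<le> N y"
    using is_norm_lower_bound[OF N] by blast
  have "\<bar>f \<bullet> y\<bar> \<le> norm f / m" if "N y = 1" for y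
  proof -
    have "norm y \<le> 1 / m" using m(1) m(2)[of y] that by (simp add: field_simps)
    then have "norm f * norm y \<le> norm f * (1 / m)" by (rule mult_left_mono) simp
    then show ?thesis using Cauchy_Schwarz_ineq2[of f y] by simp
  qed
  then have "bdd_above ((\<lambda>y. \<bar>f \<bullet> y\<bar>) ` {y. N y = 1})"
    by (intro bdd_aboveI2) auto
  moreover have "N ((1 / N x) *\<^sub>R x) = 1"
    using is_norm_pos[OF N False] by (simp add: is_norm_scaleR[OF N])
  ultimately have "\<bar>f \<bullet> ((1 / N x) *\<^sub>R x)\<bar> \<le> dual_norm N f"
    unfolding dual_norm_def by (intro cSUP_upper) auto
  then show ?thesis
    using is_norm_pos[OF N False] by (simp add: abs_mult field_simps)
qed (simp add: is_norm_zero[OF N])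

lemma dual_norm_minus: "dual_norm N (- f) = dual_norm N f"
  by (simp add: dual_norm_def)

lemma support_functional_minus:
  "support_functional N (- x) (- f) \<longleftrightarrow> support_functional N x f"
  by (simp add: support_functional_def dual_norm_minus)

lemma smooth_at_minus:
  assumes "smooth_at N x"
  shows "smooth_at N (- x)"
    and "(THE f. support_functional N (- x) f) = - (THE f. support_functional N x f)"
proof -
  obtain f where f: "support_functional N x f" "\<And>g. support_functional N x g \<Longrightarrow> g = f"
    using assms by (auto simp: smooth_at_def)
  have "support_functional N (- x) (- f)" using f(1) by (simp add: support_functional_minus)
  moreover have g: "g = - f" if "support_functional N (- x) g" for g
    using f(2)[of "- g"] support_functional_minus[of N x "- g"] that by (metis minus_minus)
  ultimately show "smooth_at N (- x)" unfolding smooth_at_def by blast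
  show "(THE f. support_functional N (- x) f) = - (THE f. support_functional N x f)"
    using the_equality[of "support_functional N x" f]
      the_equality[of "support_functional N (- x)" "- f"] f g
      \<open>support_functional N (- x) (- f)\<close> by metis
qed

text \<open>Boundedness of the supremum is the issue: for dual norm 1, pairing \<open>g\<close> with
  itself gives \<open>(norm g)\<^sup>2 \<le> N g\<close>, and \<open>N g\<close> is at most a
  constant times \<open>norm g\<close>.\<close>

lemma gamma_const_upper:
  assumes N: "is_norm N" and f: "dual_norm N f = 1"
  shows "(norm f)\<^sup>2 \<le> gamma_const N"
proof -
  obtain x where x: "norm x = 1" "\<And>y. N y \<le> N x * norm y"
    using is_norm_upper_bound_attained[OF N] by blast
  have "(norm g)\<^sup>2 \<le> (N x)\<^sup>2" if "dual_norm N g = 1" for g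
  proof -
    have "norm g * norm g \<le> N x * norm g"
      using dual_norm_inner_le[OF N, of g g] x(2)[of g] that
      by (simp add: power2_norm_eq_inner[symmetric] power2_eq_square)
    then have "norm g \<le> N x" using is_norm_nonneg[OF N, of x] by (cases "g = 0") auto
    then show ?thesis by (intro power_mono) auto
  qed
  then have "bdd_above ((\<lambda>g. (norm g)\<^sup>2) ` {g. dual_norm N g = 1})"
    by (intro bdd_aboveI2) auto
  then show ?thesis
    unfolding gamma_const_def using f by (intro cSUP_upper) auto
qed

section \<open>Smooth points and existence of placements\<close>

text \<open>A point of the unit sphere of \<open>N\<close> closest to the origin in the Euclidean norm is
  smooth: a Euclidean ball touches the sphere there from inside.\<close>

lemma smooth_at_exists:
  fixes N :: "real^'d \<Rightarrow> real"
  assumes N: "is_norm N"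
  obtains x where "N x = 1" "smooth_at N x"
proof -
  obtain x1 where x1: "norm x1 = 1" "\<And>y. N y \<le> N x1 * norm y"
    using is_norm_upper_bound_attained[OF N] by blast
  define M where "M = N x1"
  have M: "0 < M" unfolding M_def using x1(1) by (intro is_norm_pos[OF N]) auto
  have upper: "N y \<le> M * norm y" for y using x1 by (simp add: M_def)
  define x where "x = (1 / M) *\<^sub>R x1"
  \<comment> \<open>The level set of \<open>f\<close> at 1 is the tangent hyperplane at
    \<open>x\<close> to the Euclidean ball of radius \<open>1 / M\<close>.\<close>
  define f where "f = M *\<^sub>R x1"
  have Nx: "N x = 1" using M by (simp add: x_def is_norm_scaleR[OF N] M_def)
  have fx: "f \<bullet> x = 1" using M x1(1) by (simp add: f_def x_def norm_eq_1)
  have f_le: "f \<bullet> y \<le> 1" if y: "N y = 1" for y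
  proof (rule ccontr)
    assume "\<not> f \<bullet> y \<le> 1"
    define d where "d = f \<bullet> y - 1"
    have d: "0 < d" using \<open>\<not> f \<bullet> y \<le> 1\<close> by (simp add: d_def)
    define q where "q = (norm (M *\<^sub>R (x - y)))\<^sup>2"
    \<comment> \<open>Small enough that the quadratic term in the expansion of the squared norm
      below stays under the linear gain.\<close>
    define t where "t = d / (q + 1)"
    have t: "0 < t" "t * q < d"
      using d by (auto simp: t_def q_def field_simps add_pos_nonneg)
    \<comment> \<open>Moving from \<open>x\<close> away from \<open>y\<close> by \<open>t\<close>
      enters the open Euclidean ball, where \<open>N < 1\<close>. Yet the triangle inequality for
      \<open>(1 + t) *\<^sub>R x\<close> forces \<open>N \<ge> 1\<close> there.\<close>
    have "1 + t = N ((1 + t) *\<^sub>R x)"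
      using t(1) Nx by (simp add: is_norm_scaleR[OF N])
    also have "(1 + t) *\<^sub>R x = (x + t *\<^sub>R (x - y)) + t *\<^sub>R y"
      by (simp add: algebra_simps)
    also have "N \<dots> \<le> N (x + t *\<^sub>R (x - y)) + t"
      using is_norm_triangle[OF N, of "x + t *\<^sub>R (x - y)" "t *\<^sub>R y"] t(1) y
      by (simp add: is_norm_scaleR[OF N])
    also have "N (x + t *\<^sub>R (x - y)) \<le> M * norm (x + t *\<^sub>R (x - y))" by (rule upper)
    finally have "1 \<le> (M * norm (x + t *\<^sub>R (x - y)))\<^sup>2"
      using one_le_power[of "M * norm (x + t *\<^sub>R (x - y))" 2] by simp
    also have "\<dots> = (norm (x1 + t *\<^sub>R (M *\<^sub>R (x - y))))\<^sup>2"
    proof -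
      have "x1 + t *\<^sub>R (M *\<^sub>R (x - y)) = M *\<^sub>R (x + t *\<^sub>R (x - y))"
        using M by (simp add: x_def algebra_simps)
      then show ?thesis using M by simp
    qed
    also have "\<dots> = 1 + 2 * t * (x1 \<bullet> (M *\<^sub>R (x - y))) + t\<^sup>2 * q"
      using x1(1) unfolding norm_eq_1 power2_norm_eq_inner q_def
      by (simp add: inner_add_left inner_add_right inner_commute power2_eq_square algebra_simps)
    also have "x1 \<bullet> (M *\<^sub>R (x - y)) = - d"
      using fx by (simp add: d_def f_def inner_diff_right algebra_simps)
    finally have "0 \<le> t * (t * q - 2 * d)" by (simp add: power2_eq_square algebra_simps)
    then show False using t d by (simp add: zero_le_mult_iff)
  qed
  have "\<bar>f \<bullet> y\<bar> \<le> 1" if "N y = 1" for y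
    using f_le[of y] f_le[of "- y"] that by (simp add: is_norm_minus[OF N] abs_le_iff)
  then have "dual_norm N f = 1"
    unfolding dual_norm_def using Nx fx
    by (intro cSup_eq_maximum) (auto intro!: image_eqI[of _ _ x])
  then have sf: "support_functional N x f"
    using fx by (simp add: support_functional_def)
  \<comment> \<open>Equality case of Cauchy-Schwarz: \<open>norm g \<le> M\<close>, while
    \<open>g \<bullet> x = 1\<close> gives \<open>g \<bullet> f = M\<^sup>2\<close>, so the squared
    distance from \<open>g\<close> to \<open>f\<close> is at most 0.\<close>
  have "g = f" if g: "support_functional N x g" for g
  proof -
    have "norm g * norm g \<le> M * norm g"
      using dual_norm_inner_le[OF N, of g g] upper[of g] g
      by (simp add: support_functional_def power2_norm_eq_inner[symmetric] power2_eq_square)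
    then have "norm g \<le> M" using M by (cases "g = 0") auto
    then have "g \<bullet> g \<le> M\<^sup>2"
      unfolding power2_norm_eq_inner[symmetric] by (intro power_mono) auto
    moreover have "g \<bullet> f = M\<^sup>2"
      using g M by (simp add: support_functional_def x_def f_def field_simps power2_eq_square)
    moreover have "f \<bullet> f = M\<^sup>2"
      using x1(1) by (simp add: f_def norm_eq_1 power2_eq_square)
    ultimately have "(g - f) \<bullet> (g - f) \<le> 0"
      by (simp add: inner_diff_left inner_diff_right inner_commute)
    then show ?thesis by (metis eq_iff_diff_eq_0 inner_gt_zero_iff linorder_not_less)
  qed
  with sf have "smooth_at N x" unfolding smooth_at_def by blast
  with Nx that show thesis by blast
qed

text \<open>Distinct multiples of one smooth point \<open>x\<close> make every edge direction
  \<open>x\<close> or \<open>- x\<close>, and smoothness is invariant under negation.\<close>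

lemma framework_placements_nonempty:
  fixes N :: "real^'d \<Rightarrow> real" and E :: "'v::finite set set"
  assumes N: "is_norm N" and E: "simple_graph E"
  shows "framework_placements N E \<noteq> {}"
proof -
  obtain x where x: "N x = 1" "smooth_at N x" using smooth_at_exists[OF N] by blast
  have "x \<noteq> 0" using x(1) is_norm_zero[OF N] by auto
  obtain t :: "'v \<Rightarrow> nat" where t: "inj t"
    using finite_imp_inj_to_nat_seg[OF finite[of "UNIV :: 'v set"]] by blast
  define p where "p = (\<lambda>v. real (t v) *\<^sub>R x)"
  have "p v \<noteq> p w \<and> smooth_at N (unit_direction N p v w)" if "{v, w} \<in> E" for v w
  proof -
    have "v \<noteq> w" using E that by (auto simp: simple_graph_def)
    then have ne: "real (t v) - real (t w) \<noteq> 0" using t by (auto dest: injD)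
    have diff: "p v - p w = (real (t v) - real (t w)) *\<^sub>R x"
      by (simp add: p_def algebra_simps)
    then have "unit_direction N p v w = sgn (real (t v) - real (t w)) *\<^sub>R x"
      using x(1) by (simp add: unit_direction_def is_norm_scaleR[OF N] real_sgn_eq)
    then have "unit_direction N p v w = x \<or> unit_direction N p v w = - x"
      using ne by (auto simp: sgn_real_def)
    moreover have "p v \<noteq> p w" using diff ne \<open>x \<noteq> 0\<close> by auto
    ultimately show ?thesis using x(2) smooth_at_minus(1)[OF x(2)] by auto
  qed
  then show ?thesis by (auto simp: framework_placements_def)
qed

section \<open>The two Laplacians\<close>

text \<open>Pure tensors in coordinates. They separate the vertex part of a rigidity row, a signed
  incidence vector, from its functional.\<close>

definition vec_tensor :: "real^'v \<Rightarrow> real^'d \<Rightarrow> real^('v \<times> 'd)" where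
  "vec_tensor x y = (\<chi> a. x $ fst a * y $ snd a)"

lemma inner_vec_tensor:
  fixes x x' :: "real^'v::finite" and y y' :: "real^'d"
  shows "vec_tensor x y \<bullet> vec_tensor x' y' = (x \<bullet> x') * (y \<bullet> y')"
proof -
  have "vec_tensor x y \<bullet> vec_tensor x' y' =
      (\<Sum>(v, i)\<in>UNIV \<times> UNIV. (x $ v * x' $ v) * (y $ i * y' $ i))"
    by (simp add: vec_tensor_def inner_vec_def mult.assoc mult.left_commute split_beta)
  also have "\<dots> = (x \<bullet> x') * (y \<bullet> y')"
    by (simp only: sum.cartesian_product[symmetric] sum_product[symmetric] inner_vec_def
        inner_real_def)
  finally show ?thesis .
qed

lemma edge_orientation:
  fixes E :: "'v::finite set set"
  assumes "simple_graph E"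
  obtains s t where "\<And>e. e \<in> E \<Longrightarrow> {s e, t e} = e \<and> s e \<noteq> t e"
proof -
  have "\<forall>e\<in>E. \<exists>a. {fst a, snd a} = e \<and> fst a \<noteq> snd a"
  proof
    fix e assume "e \<in> E"
    then obtain a b where "e = {a, b}" "a \<noteq> b"
      using assms by (auto simp: simple_graph_def card_2_iff)
    then show "\<exists>a. {fst a, snd a} = e \<and> fst a \<noteq> snd a"
      by (intro exI[of _ "(a, b)"]) simp
  qed
  then obtain h where "\<forall>e\<in>E. {fst (h e), snd (h e)} = e \<and> fst (h e) \<noteq> snd (h e)"
    by (rule bchoice[THEN exE])
  then show thesis using that[of "\<lambda>e. fst (h e)" "\<lambda>e. snd (h e)"] by blast
qed

text \<open>The rows are signed incidence vectors of an arbitrary orientation; reversing an edge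
  flips both factors of each product, so the choice does not matter.\<close>

lemma graph_laplacian_eq_gram_matrix:
  fixes E :: "'v::finite set set"
  assumes st: "\<And>e. e \<in> E \<Longrightarrow> {s e, t e} = e \<and> s e \<noteq> t e"
  shows "graph_laplacian E = gram_matrix E (\<lambda>e. axis (s e) 1 - axis (t e) 1)"
proof -
  let ?b = "\<lambda>e. axis (s e) 1 - axis (t e) (1::real)"
  have "graph_laplacian E $ u $ w = (\<Sum>e\<in>E. ?b e $ u * ?b e $ w)" for u w
  proof (cases "u = w")
    case True
    have "(\<Sum>e\<in>E. ?b e $ u * ?b e $ w) = (\<Sum>e\<in>E. if u \<in> e then 1 else 0)"
    proof (rule sum.cong)
      fix e assume "e \<in> E"
      show "?b e $ u * ?b e $ w = (if u \<in> e then 1 else 0)"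
        using st[OF \<open>e \<in> E\<close>] True by (auto simp: axis_def)
    qed simp
    also have "\<dots> = real (card {e \<in> E. u \<in> e})"
      by (simp add: sum.inter_filter[symmetric])
    finally show ?thesis using True by (simp add: graph_laplacian_def)
  next
    case False
    have "(\<Sum>e\<in>E. ?b e $ u * ?b e $ w) = (\<Sum>e\<in>E. if e = {u, w} then - 1 else 0)"
    proof (rule sum.cong)
      fix e assume "e \<in> E"
      have "e = {u, w} \<longleftrightarrow> s e = u \<and> t e = w \<or> s e = w \<and> t e = u"
        using st[OF \<open>e \<in> E\<close>] by (metis doubleton_eq_iff)
      then show "?b e $ u * ?b e $ w = (if e = {u, w} then - 1 else 0)"
        using st[OF \<open>e \<in> E\<close>] False by (auto simp: axis_def)
    qed simp
    then show ?thesis using False by (simp add: graph_laplacian_def)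
  qed
  then show ?thesis by (simp add: gram_matrix_def vec_eq_iff)
qed

lemma edge_functional_swap:
  assumes "is_norm N" "p \<in> framework_placements N E" "{v, w} \<in> E"
  shows "edge_functional N p w v = - edge_functional N p v w"
proof -
  have "N (p w - p v) = N (p v - p w)"
    using is_norm_minus[OF assms(1), of "p v - p w"] by simp
  then have "unit_direction N p w v = - unit_direction N p v w"
    by (simp add: unit_direction_def scaleR_diff_right)
  then show ?thesis
    using smooth_at_minus(2)[of N "unit_direction N p v w"] assms(2,3)
    by (simp add: edge_functional_def framework_placements_def)
qed

lemma dual_norm_edge_functional:
  assumes "p \<in> framework_placements N E" "{v, w} \<in> E"
  shows "dual_norm N (edge_functional N p v w) = 1"
proof -
  have "\<exists>!f. support_functional N (unit_direction N p v w) f"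
    using assms by (auto simp: framework_placements_def smooth_at_def)
  from theI'[OF this] show ?thesis
    by (simp add: edge_functional_def support_functional_def)
qed

text \<open>The blocks of a rigidity row at the two endpoints are opposite functionals by
  \<open>edge_functional_swap\<close>, so the row is one tensor.\<close>

lemma framework_laplacian_eq_gram_matrix:
  fixes N :: "real^'d \<Rightarrow> real" and E :: "'v::finite set set"
  assumes N: "is_norm N" and p: "p \<in> framework_placements N E"
    and st: "\<And>e. e \<in> E \<Longrightarrow> {s e, t e} = e \<and> s e \<noteq> t e"
  shows "framework_laplacian N E p = gram_matrix E
    (\<lambda>e. vec_tensor (axis (s e) 1 - axis (t e) 1) (edge_functional N p (s e) (t e)))"
proof -
  have "rigidity_matrix N p e (u, i) =
      vec_tensor (axis (s e) 1 - axis (t e) 1) (edge_functional N p (s e) (t e)) $ (u, i)"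
    if e: "e \<in> E" for e u i
  proof -
    have "e = {s e, w} \<longleftrightarrow> w = t e" "e = {t e, w} \<longleftrightarrow> w = s e" for w
      using st[OF e] by (metis doubleton_eq_iff)+
    then have "(THE w. e = {s e, w}) = t e" "(THE w. e = {t e, w}) = s e"
      by simp_all
    moreover have "edge_functional N p (t e) (s e) = - edge_functional N p (s e) (t e)"
      using edge_functional_swap[OF N p, of "s e" "t e"] st[OF e] e by simp
    moreover have "u \<in> e \<longleftrightarrow> u = s e \<or> u = t e" using st[OF e] by blast
    ultimately show ?thesis
      using st[OF e] by (auto simp: rigidity_matrix_def vec_tensor_def axis_def)
  qed
  then show ?thesis
    by (simp add: framework_laplacian_def gram_matrix_def vec_eq_iff)
qed

section \<open>The test space and the trace estimate\<close>

lemma dim_tensor_test_space: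
  fixes y u :: "real^'v::finite"
  assumes y: "norm y = 1" "y \<bullet> u = 0" and u: "u \<noteq> 0"
  defines "T \<equiv> \<lambda>(z :: real^'d, c). vec_tensor y z + vec_tensor u c"
  shows "subspace (range T)" "dim (range T) = 2 * CARD('d)"
proof -
  have lin: "linear T"
    by (rule linearI) (auto simp: T_def vec_tensor_def vec_eq_iff algebra_simps)
  then show "subspace (range T)" by (simp add: linear_subspace_image)
  \<comment> \<open>Since \<open>y\<close> and \<open>u\<close> are orthogonal and nonzero, pairing
    \<open>T a\<close> with each of its two summands detects \<open>z\<close> and \<open>c\<close>
    separately.\<close>
  have "a = 0" if "T a = 0" for a
  proof -
    obtain z c where a: "a = (z, c)" by force
    have "T a \<bullet> vec_tensor y z = z \<bullet> z" "T a \<bullet> vec_tensor u c = (u \<bullet> u) * (c \<bullet> c)"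
      using y by (simp_all add: a T_def inner_add_left inner_vec_tensor norm_eq_1
          inner_commute[of u y])
    then show ?thesis using that u by (simp add: a zero_prod_def)
  qed
  then have "inj T" using lin by (simp add: linear_injective_0)
  then show "dim (range T) = 2 * CARD('d)"
    using dim_image_eq[OF lin, of UNIV] by simp
qed

text \<open>The trace estimate for a single placement, in multiplied-out form; \<open>k\<close> is
  any number below \<open>2 * CARD('d)\<close>, and rigid motions enter only when it is
  specialised.\<close>

lemma framework_laplacian_eigenvalue_le:
  fixes N :: "real^'d \<Rightarrow> real" and E :: "'v::finite set set"
  assumes N: "is_norm N" and E: "simple_graph E" and p: "p \<in> framework_placements N E"
    and k: "k < 2 * CARD('d)" and card: "2 \<le> CARD('v)" and gamma: "0 \<le> gamma_const N"
  shows "real (2 * CARD('d) - k) * ordered_eigenvalue (k + 1) (framework_laplacian N E p)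
    \<le> gamma_const N * algebraic_connectivity E"
proof -
  obtain s t where st: "\<And>e. e \<in> E \<Longrightarrow> {s e, t e} = e \<and> s e \<noteq> t e"
    using edge_orientation[OF E] by blast
  define b :: "'v set \<Rightarrow> real^'v" where "b = (\<lambda>e. axis (s e) 1 - axis (t e) 1)"
  define \<phi> where "\<phi> = (\<lambda>e. edge_functional N p (s e) (t e))"
  have L: "graph_laplacian E = gram_matrix E b"
    unfolding b_def by (rule graph_laplacian_eq_gram_matrix[OF st])
  have FL: "framework_laplacian N E p = gram_matrix E (\<lambda>e. vec_tensor (b e) (\<phi> e))"
    unfolding b_def \<phi>_def by (rule framework_laplacian_eq_gram_matrix[OF N p st])
  have b1: "b e \<bullet> 1 = 0" for e
    by (simp add: b_def inner_diff_left inner_axis')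
  then have "1 \<in> eigenspace (graph_laplacian E) 0"
    by (simp add: L eigenspace_def gram_matrix_mult_vec)
  then obtain y where y: "norm y = 1" "y \<bullet> 1 = 0"
    and ray: "y \<bullet> (graph_laplacian E *v y) \<le> algebraic_connectivity E"
    using second_eigenvalue_test_vector[OF _ card, of "graph_laplacian E" 1 0]
    unfolding algebraic_connectivity_def L transpose_gram_matrix by auto
  \<comment> \<open>The tensors \<open>vec_tensor 1 c\<close> are the translations: every row
    annihilates them, so they add \<open>CARD('d)\<close> dimensions but nothing to the
    trace.\<close>
  define W where "W = range (\<lambda>(z :: real^'d, c). vec_tensor y z + vec_tensor 1 c)"
  \<comment> \<open>This is the orthogonal projection of the row onto \<open>W\<close>: as
    \<open>b e\<close> is orthogonal to \<open>1\<close>, only its component along \<open>y\<close>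
    survives.\<close>
  define z where "z = (\<lambda>e. vec_tensor ((b e \<bullet> y) *\<^sub>R y) (\<phi> e))"
  have W: "subspace W" "dim W = 2 * CARD('d)"
    unfolding W_def by (rule dim_tensor_test_space[OF y]; simp)+
  have "vec_tensor (b e) (\<phi> e) \<bullet> x = z e \<bullet> x" if "x \<in> W" for e x
    using that y b1
    by (auto simp: W_def z_def inner_add_right inner_vec_tensor norm_eq_1)
  then have "real (2 * CARD('d) - k) * ordered_eigenvalue (k + 1) (framework_laplacian N E p)
      \<le> (\<Sum>e\<in>E. (norm (z e))\<^sup>2)"
    using ordered_eigenvalue_gram_matrix_le[OF W(1), of k E "\<lambda>e. vec_tensor (b e) (\<phi> e)" z] k
    unfolding FL W(2) by blast
  also have "\<dots> \<le> (\<Sum>e\<in>E. gamma_const N * (b e \<bullet> y)\<^sup>2)"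
  proof (rule sum_mono)
    fix e assume e: "e \<in> E"
    have "dual_norm N (\<phi> e) = 1"
      unfolding \<phi>_def using dual_norm_edge_functional[OF p, of "s e" "t e"] st[OF e] e by simp
    then have "(norm (\<phi> e))\<^sup>2 \<le> gamma_const N" by (rule gamma_const_upper[OF N])
    then have "(norm (\<phi> e))\<^sup>2 * (b e \<bullet> y)\<^sup>2 \<le> gamma_const N * (b e \<bullet> y)\<^sup>2"
      by (rule mult_right_mono) simp
    moreover have "(norm (z e))\<^sup>2 = (norm (\<phi> e))\<^sup>2 * (b e \<bullet> y)\<^sup>2"
      using y(1) unfolding power2_norm_eq_inner z_def inner_vec_tensor norm_eq_1
      by (simp add: power2_eq_square)
    ultimately show "(norm (z e))\<^sup>2 \<le> gamma_const N * (b e \<bullet> y)\<^sup>2" by simp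
  qed
  also have "\<dots> = gamma_const N * (y \<bullet> (graph_laplacian E *v y))"
    by (simp add: L gram_matrix_quadratic_form sum_distrib_left)
  also have "\<dots> \<le> gamma_const N * algebraic_connectivity E"
    using ray gamma by (rule mult_left_mono)
  finally show ?thesis .
qed

theorem theorem3p23:
  fixes N :: "real^'d \<Rightarrow> real" and E :: "'v::finite set set"
  assumes "is_norm N"
    and "rigid_motion_dim N \<le> 2 * CARD('d) - 1"
    and "simple_graph E"
    and "CARD('v) \<ge> CARD('d) + 1"
  shows "algebraic_connectivity_in N E
    \<le> gamma_const N / (2 * real CARD('d) - real (rigid_motion_dim N)) * algebraic_connectivity E"
proof -
  let ?k = "rigid_motion_dim N"
  \<comment> \<open>Positivity of the dimension makes the truncated subtraction in the hypothesis
    genuine and gives at least two vertices, so a second Laplacian eigenvalue exists.\<close>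
  have d: "0 < CARD('d)" by simp
  then have k: "?k < 2 * CARD('d)" using assms(2) by linarith
  have card: "2 \<le> CARD('v)" using d assms(4) by linarith
  \<comment> \<open>A support functional at a smooth point witnesses that \<open>gamma_const\<close>
    dominates a square; its nonnegativity is used to multiply the Rayleigh bound for
    \<open>y\<close>.\<close>
  obtain x f where "support_functional N x f"
    using smooth_at_exists[OF assms(1)] unfolding smooth_at_def by metis
  then have "dual_norm N f = 1" by (simp add: support_functional_def)
  from gamma_const_upper[OF assms(1) this] have gamma: "0 \<le> gamma_const N"
    using zero_le_power2[of "norm f"] by linarith
  have "ordered_eigenvalue (?k + 1) (framework_laplacian N E p)
      \<le> gamma_const N / (2 * real CARD('d) - real ?k) * algebraic_connectivity E"
    if p: "p \<in> framework_placements N E" for p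
    using framework_laplacian_eigenvalue_le[OF assms(1,3) p k card gamma] k
    by (simp add: of_nat_diff field_simps)
  then show ?thesis
    unfolding algebraic_connectivity_in_def
    by (intro cSUP_least framework_placements_nonempty assms)
qed

end
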